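(* Let $D$ be a finite oriented graph and let $\ell$ be largest such that $D$ contains (as a subgraph) an orientation of $K_\ell$. Then, asymptotically almost surely, a uniformly random labelled $D$-coloured digraph is such that the image of its colouring homomorphism to $D$ is contained in a subgraph of $D$ which is an orientation of a blow-up of $K_\ell$.
   Context: An oriented graph is an irreflexive digraph with antisymmetric edge relation. A $D$-coloured digraph is a digraph $G$ with unary predicates $P_u$, $u\in V(D)$, such that each vertex lies in exactly one $P_u$ and the map $x\mapsto u$ for $x\in P_u$ is a homomorphism $G\to D$ (the colouring homomorphism). Labelled means vertex set $\{1,\dots,n\}$; a property holds asymptotically almost surely if the fraction of labelled $D$-coloured digraphs on $\{1,\dots,n\}$ having it tends to $1$ as $n\to\infty$. A blow-up of $K_\ell$ is obtained by replacing each vertex by a non-empty set of copies with the same neighbours and no edges among copies of the same vertex; an orientation of an undirected graph chooses exactly one direction for each edge. *)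

theory Defs
  imports Complex_Main "HOL-Library.FuncSet"
begin

definition oriented_graph :: "'v set \<Rightarrow> ('v \<times> 'v) set \<Rightarrow> bool" where
  "oriented_graph V E \<longleftrightarrow> E \<subseteq> V \<times> V \<and> irrefl E \<and> antisym E"

definition subgraph :: "'v set \<Rightarrow> ('v \<times> 'v) set \<Rightarrow> 'v set \<Rightarrow> ('v \<times> 'v) set \<Rightarrow> bool" where
  "subgraph W F V E \<longleftrightarrow> W \<subseteq> V \<and> F \<subseteq> E \<and> F \<subseteq> W \<times> W"

definition orientation_of_complete :: "'v set \<Rightarrow> ('v \<times> 'v) set \<Rightarrow> bool" where
  "orientation_of_complete W F \<longleftrightarrow> F \<subseteq> W \<times> W \<and>
     (\<forall>x\<in>W. \<forall>y\<in>W. ((x, y) \<in> F \<or> (y, x) \<in> F \<longleftrightarrow> x \<noteq> y)) \<and> antisym F"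

definition contains_oriented_K :: "'v set \<Rightarrow> ('v \<times> 'v) set \<Rightarrow> nat \<Rightarrow> bool" where
  "contains_oriented_K V E k \<longleftrightarrow>
     (\<exists>W F. subgraph W F V E \<and> finite W \<and> card W = k \<and> orientation_of_complete W F)"

text \<open>(W,F) is an orientation of a blow-up of K_l: there is a map p from W onto the
  vertices {0..<l} of K_l (each vertex of K_l gets a non-empty set of copies) such that
  distinct x,y are adjacent (in exactly one direction) iff p x \<noteq> p y.\<close>
definition orientation_of_blowup_K :: "nat \<Rightarrow> 'v set \<Rightarrow> ('v \<times> 'v) set \<Rightarrow> bool" where
  "orientation_of_blowup_K l W F \<longleftrightarrow> F \<subseteq> W \<times> W \<and> antisym F \<and>
     (\<exists>p. p ` W = {0..<l} \<and>
        (\<forall>x\<in>W. \<forall>y\<in>W. ((x, y) \<in> F \<or> (y, x) \<in> F \<longleftrightarrow> p x \<noteq> p y)))"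

definition coloured_digraphs ::
  "'v set \<Rightarrow> ('v \<times> 'v) set \<Rightarrow> nat \<Rightarrow> ((nat \<Rightarrow> 'v) \<times> (nat \<times> nat) set) set" where
  "coloured_digraphs V E n = {(c, G). c \<in> {1..n} \<rightarrow>\<^sub>E V \<and> G \<subseteq> {1..n} \<times> {1..n} \<and> irrefl G \<and>
      (\<forall>(x, y)\<in>G. (c x, c y) \<in> E)}"

definition image_in_blowup ::
  "'v set \<Rightarrow> ('v \<times> 'v) set \<Rightarrow> nat \<Rightarrow> nat \<Rightarrow> (nat \<Rightarrow> 'v) \<times> (nat \<times> nat) set \<Rightarrow> bool" where
  "image_in_blowup V E l n cG \<longleftrightarrow> (case cG of (c, G) \<Rightarrow>
     (\<exists>W F. subgraph W F V E \<and> orientation_of_blowup_K l W F \<and>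
        c ` {1..n} \<subseteq> W \<and> (\<lambda>(x, y). (c x, c y)) ` G \<subseteq> F))"

end

theory Submission
  imports Defs "HOL-Analysis.Convex" "HOL-Real_Asymp.Real_Asymp"
begin

text \<open>
  A map \<open>c\<close> from the labels to \<open>D\<close> is the colouring of exactly \<open>2^e(c)\<close> digraphs, where \<open>e(c)\<close>
  counts the pairs mapped to edges, so it suffices to show that most of the total weight
  \<open>Z = \<Sum>c. 2^e(c)\<close> is carried by those \<open>c\<close> whose image induces a complete \<open>l\<close>-partite graph.
  The exceptional colourings lose an exponential factor to a modified colouring, at a polynomial
  price per recoloured vertex. With \<open>k\<close> about \<open>sqrt n\<close>: (1) a used colour whose degree is not
  almost maximal gains by recolouring one vertex; (2) if a used colour \<open>v\<close> is adjacent to neither of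
  two adjacent colours \<open>u\<close>, \<open>w\<close> with classes of size at least \<open>k\<close>, moving \<open>k\<close> vertices of each to
  \<open>v\<close> gains about \<open>k^2\<close> edges, because \<open>e\<close> is a quadratic form; (3) if \<open>e(c)\<close> falls more than
  \<open>C n\<close> short of \<open>(1 - 1/l) n^2/2\<close>, a balanced colouring by an \<open>l\<close>-clique alone outweighs all such
  \<open>c\<close>. In the remaining colourings the classes of size at least \<open>k\<close> form a complete
  \<open>l\<close>-partite graph with parts of linear size, and every used colour belongs to one of the parts.
  (4) If some used colour \<open>w\<close> has a class smaller than \<open>k\<close>, recolour all small classes inside their
  parts without losing edges; then any subset of a large class in the part of \<open>w\<close> may be recoloured to
  \<open>w\<close> at no cost, which is exponentially many colourings against \<open>exp (O(sqrt n * log n))\<close>.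
\<close>

lemma sum_Un_le:
  fixes f :: "'a \<Rightarrow> real"
  assumes "finite A" "finite B" "\<And>x. f x \<ge> 0"
  shows "sum f (A \<union> B) \<le> sum f A + sum f B"
  using sum.union_inter[of A B f] sum_nonneg[of "A \<inter> B" f] assms by simp

lemma sum_UN_le:
  fixes f :: "'a \<Rightarrow> real"
  assumes "finite I" "\<And>i. i \<in> I \<Longrightarrow> finite (B i)" "\<And>x. f x \<ge> 0"
  shows "sum f (\<Union>i\<in>I. B i) \<le> (\<Sum>i\<in>I. sum f (B i))"
  using assms(1,2)
proof (induction I rule: finite_induct)
  case (insert i I)
  have "sum f (B i \<union> (\<Union>i\<in>I. B i)) \<le> sum f (B i) + sum f (\<Union>i\<in>I. B i)"
    using insert assms(3) by (intro sum_Un_le) auto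
  thus ?case using insert by simp
qed simp

section \<open>Weights of colourings and switching\<close>

locale finite_oriented_graph =
  fixes V :: "'v set" and E :: "('v \<times> 'v) set"
  assumes finV: "finite V" and V_ne: "V \<noteq> {}" and oriented: "oriented_graph V E"
begin

section \<open>Edge counts as a quadratic form in the class sizes\<close>

definition adj :: "'v \<Rightarrow> 'v \<Rightarrow> bool" where
  "adj u v \<longleftrightarrow> (u, v) \<in> E \<or> (v, u) \<in> E"

definition adjm :: "'v \<Rightarrow> 'v \<Rightarrow> real" where
  "adjm u v = of_bool (adj u v)"

definition quad :: "('v \<Rightarrow> real) \<Rightarrow> real" where
  "quad x = (\<Sum>u\<in>V. \<Sum>v\<in>V. adjm u v * x u * x v)"

abbreviation cols :: "nat \<Rightarrow> (nat \<Rightarrow> 'v) set" where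
  "cols n \<equiv> {1..n} \<rightarrow>\<^sub>E V"

definition class_size :: "nat \<Rightarrow> (nat \<Rightarrow> 'v) \<Rightarrow> 'v \<Rightarrow> nat" where
  "class_size n c u = card {x\<in>{1..n}. c x = u}"

definition edges :: "nat \<Rightarrow> (nat \<Rightarrow> 'v) \<Rightarrow> (nat \<times> nat) set" where
  "edges n c = {(x, y). x \<in> {1..n} \<and> y \<in> {1..n} \<and> (c x, c y) \<in> E}"

definition wt :: "nat \<Rightarrow> (nat \<Rightarrow> 'v) \<Rightarrow> real" where
  "wt n c = 2 ^ card (edges n c)"

text \<open>Half the partial derivative of \<open>quad\<close> at the class sizes; for a used
  colour, the number of allowed neighbours of each of its vertices.\<close>

definition deg :: "nat \<Rightarrow> (nat \<Rightarrow> 'v) \<Rightarrow> 'v \<Rightarrow> real" where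
  "deg n c u = (\<Sum>v\<in>V. adjm u v * class_size n c v)"

lemma adj_sym: "adj u v \<longleftrightarrow> adj v u"
  by (auto simp: adj_def)

lemma adj_irrefl [simp]: "\<not> adj u u"
  using oriented by (auto simp: adj_def oriented_graph_def irrefl_def)

lemma adjm_sym: "adjm u v = adjm v u"
  using adj_sym by (simp add: adjm_def)

text \<open>Irreflexivity and antisymmetry leave at most one of the two directions, so the two
  indicators can be added.\<close>

lemma adjm_split: "adjm u v = of_bool ((u, v) \<in> E) + of_bool ((v, u) \<in> E)"
  using oriented by (auto simp: adjm_def adj_def oriented_graph_def irrefl_def antisym_def)

lemma wt_pos [simp]: "wt n c > 0"
  by (simp add: wt_def)

lemma finite_cols: "finite (cols n)"
  using finV by (intro finite_PiE) auto

\<comment> \<open>The simplifier rewrites \<open>{1..n}\<close> to \<open>{Suc 0..n}\<close>, so the rule above would never match.\<close>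
lemmas finite_cols_Suc_0 [simp] = finite_cols[unfolded One_nat_def]

lemma finite_edges [simp]: "finite (edges n c)"
  by (rule finite_subset[of _ "{1..n} \<times> {1..n}"]) (auto simp: edges_def)

lemma sum_colours:
  fixes g :: "'v \<Rightarrow> real"
  assumes "c \<in> cols n"
  shows "(\<Sum>x=1..n. g (c x)) = (\<Sum>u\<in>V. class_size n c u * g u)"
proof -
  have "(\<Sum>u\<in>V. class_size n c u * g u) = (\<Sum>u\<in>V. \<Sum>x | x \<in> {1..n} \<and> c x = u. g (c x))"
    by (intro sum.cong) (auto simp: class_size_def)
  also have "\<dots> = (\<Sum>x=1..n. g (c x))"
    using assms finV by (intro sum.group) auto
  finally show ?thesis by simp
qed

lemma sum_class_size: "c \<in> cols n \<Longrightarrow> (\<Sum>u\<in>V. real (class_size n c u)) = n"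
  using sum_colours[of c n "\<lambda>_. 1"] by simp

lemma two_edges: "2 * real (card (edges n c)) = (\<Sum>x=1..n. \<Sum>y=1..n. adjm (c x) (c y))"
proof -
  have *: "real (card (edges n c)) = (\<Sum>x=1..n. \<Sum>y=1..n. of_bool ((c x, c y) \<in> E))"
  proof -
    have "(\<Sum>x=1..n. \<Sum>y=1..n. of_bool ((c x, c y) \<in> E))
        = (\<Sum>(x, y)\<in>{1..n}\<times>{1..n}. of_bool ((c x, c y) \<in> E) :: real)"
      by (rule sum.cartesian_product)
    also have "\<dots> = (\<Sum>z\<in>edges n c. 1)"
      by (rule sum.mono_neutral_cong_right) (auto simp: edges_def)
    finally show ?thesis by simp
  qed
  have "(\<Sum>x=1..n. \<Sum>y=1..n. of_bool ((c y, c x) \<in> E) :: real)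
      = (\<Sum>x=1..n. \<Sum>y=1..n. of_bool ((c x, c y) \<in> E))"
    by (rule sum.swap)
  thus ?thesis by (simp add: adjm_split sum.distrib *)
qed

text \<open>By \<open>two_edges\<close> only the undirected relation matters: a recolouring may
  reverse directions at no cost.\<close>

lemma card_edges_mono:
  assumes "\<And>x y. x \<in> {1..n} \<Longrightarrow> y \<in> {1..n} \<Longrightarrow> adj (c x) (c y) \<Longrightarrow> adj (c' x) (c' y)"
  shows "card (edges n c) \<le> card (edges n c')"
proof -
  have "(\<Sum>x=1..n. \<Sum>y=1..n. adjm (c x) (c y)) \<le> (\<Sum>x=1..n. \<Sum>y=1..n. adjm (c' x) (c' y))"
    using assms by (intro sum_mono) (auto simp: adjm_def)
  thus ?thesis unfolding two_edges[symmetric] by simp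
qed

lemma quad_class_size:
  assumes "c \<in> cols n"
  shows "quad (class_size n c) = 2 * card (edges n c)"
proof -
  have "(\<Sum>x=1..n. \<Sum>y=1..n. adjm (c x) (c y))
      = (\<Sum>x=1..n. \<Sum>v\<in>V. class_size n c v * adjm (c x) v)"
    by (intro sum.cong refl sum_colours assms)
  also have "\<dots> = (\<Sum>u\<in>V. class_size n c u * (\<Sum>v\<in>V. class_size n c v * adjm u v))"
    by (rule sum_colours[OF assms])
  also have "\<dots> = quad (class_size n c)"
    by (simp add: quad_def sum_distrib_left mult_ac)
  finally show ?thesis by (simp add: two_edges)
qed

lemma quad_add:
  "quad (\<lambda>u. x u + d u) = quad x + 2 * (\<Sum>u\<in>V. d u * (\<Sum>v\<in>V. adjm u v * x v)) + quad d"
proof -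
  have "(\<Sum>u\<in>V. \<Sum>v\<in>V. adjm u v * x u * d v) = (\<Sum>v\<in>V. \<Sum>u\<in>V. adjm u v * x u * d v)"
    by (rule sum.swap)
  also have "\<dots> = (\<Sum>u\<in>V. d u * (\<Sum>v\<in>V. adjm u v * x v))"
    by (simp add: sum_distrib_left mult_ac adjm_sym)
  finally have 1: "(\<Sum>u\<in>V. \<Sum>v\<in>V. adjm u v * x u * d v) = \<dots>" .
  have 2: "(\<Sum>u\<in>V. \<Sum>v\<in>V. adjm u v * d u * x v) = (\<Sum>u\<in>V. d u * (\<Sum>v\<in>V. adjm u v * x v))"
    by (simp add: sum_distrib_left mult_ac)
  have "quad (\<lambda>u. x u + d u) = quad x + (\<Sum>u\<in>V. \<Sum>v\<in>V. adjm u v * x u * d v)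
     + (\<Sum>u\<in>V. \<Sum>v\<in>V. adjm u v * d u * x v) + quad d"
    by (simp add: quad_def sum.distrib[symmetric] algebra_simps)
  with 1 2 show ?thesis by simp
qed

text \<open>The exact second-order expansion of a quadratic form, with \<open>deg\<close> as
  gradient; moving vertices between a few colours thus reduces to evaluating \<open>quad\<close> at
  a sparse vector.\<close>

lemma card_edges_perturb:
  fixes d :: "'v \<Rightarrow> real"
  assumes "c \<in> cols n" "c' \<in> cols n"
    and "\<And>u. u \<in> V \<Longrightarrow> real (class_size n c' u) = class_size n c u + d u"
  shows "2 * real (card (edges n c')) =
    2 * card (edges n c) + 2 * (\<Sum>u\<in>V. d u * deg n c u) + quad d"
proof -
  have "quad (class_size n c') = quad (\<lambda>u. class_size n c u + d u)"
    unfolding quad_def using assms(3) by (intro sum.cong) auto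
  thus ?thesis
    unfolding quad_add quad_class_size[OF assms(1)] quad_class_size[OF assms(2)] deg_def by simp
qed

section \<open>Hamming balls and the switching inequality\<close>

lemma card_cols_ball:
  assumes "c' \<in> cols n" "n \<ge> 1"
  shows "card {c\<in>cols n. card {x\<in>{1..n}. c x \<noteq> c' x} \<le> r} \<le> (n * card V) ^ r"
proof (induction r)
  case 0
  have "{c\<in>cols n. card {x\<in>{1..n}. c x \<noteq> c' x} \<le> 0} \<subseteq> {c'}"
  proof
    fix c assume c: "c \<in> {c\<in>cols n. card {x\<in>{1..n}. c x \<noteq> c' x} \<le> 0}"
    hence "\<And>x. x \<in> {1..n} \<Longrightarrow> c x = c' x" by auto
    thus "c \<in> {c'}" using c assms(1) PiE_ext[of c "{1..n}" "\<lambda>_. V" c'] by blast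
  qed
  from card_mono[OF _ this] show ?case by simp
next
  case (Suc r)
  let ?S = "\<lambda>r. {c\<in>cols n. card {x\<in>{1..n}. c x \<noteq> c' x} \<le> r}"
  \<comment> \<open>Correcting one disagreement with \<open>c'\<close> leads into the smaller ball;
    undoing this takes a vertex and a colour, hence a factor \<open>n * card V\<close> per unit of
    radius.\<close>
  have "?S (Suc r) \<subseteq> (\<lambda>(c, j, v). c(j := v)) ` (?S r \<times> {1..n} \<times> V)"
  proof
    fix c assume c: "c \<in> ?S (Suc r)"
    define D where "D = {x\<in>{1..n}. c x \<noteq> c' x}"
    have "\<exists>x\<in>{1..n}. card {y\<in>{1..n}. (c(x := c' x)) y \<noteq> c' y} \<le> r"
    proof (cases "D = {}")
      case True
      \<comment> \<open>There is nothing to correct, so any vertex serves; vertex 1 exists as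
        \<open>n \<ge> 1\<close>.\<close>
      hence "{y\<in>{1..n}. (c(1 := c' 1)) y \<noteq> c' y} = {}" by (auto simp: D_def)
      thus ?thesis using assms(2) by (intro bexI[of _ 1]) (simp_all only: card.empty, auto)
    next
      case False
      then obtain x where x: "x \<in> D" by auto
      have "{y\<in>{1..n}. (c(x := c' x)) y \<noteq> c' y} = D - {x}"
        using x by (auto simp: D_def)
      moreover have "card D \<le> Suc r" using c by (simp add: D_def)
      hence "card (D - {x}) \<le> r" using x by (simp only: card_Diff_singleton)
      ultimately show ?thesis using x by (intro bexI[of _ x]) (auto simp: D_def)
    qed
    then obtain x where x: "x \<in> {1..n}" "card {y\<in>{1..n}. (c(x := c' x)) y \<noteq> c' y} \<le> r" by blast
    have "c(x := c' x) \<in> ?S r"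
      using c x assms(1) by (auto simp: PiE_iff extensional_def)
    moreover have "c = (c(x := c' x))(x := c x)" by simp
    moreover have "c x \<in> V" using c x by auto
    ultimately show "c \<in> (\<lambda>(c, j, v). c(j := v)) ` (?S r \<times> {1..n} \<times> V)"
      using x(1) by (intro image_eqI[of _ _ "(c(x := c' x), x, c x)"]) auto
  qed
  hence "card (?S (Suc r)) \<le> card (?S r \<times> {1..n} \<times> V)"
    using finV by (intro surj_card_le) auto
  also have "\<dots> = card (?S r) * (n * card V)" by (simp add: card_cartesian_product)
  also have "\<dots> \<le> (n * card V) ^ r * (n * card V)" by (intro mult_right_mono Suc) auto
  finally show ?case by (simp add: mult_ac)
qed

text \<open>Double counting along a choice of \<open>c'\<close> for each \<open>c\<close>: weights
  grow by a factor of at least \<open>2 ^ m\<close>, and each fibre lies in a Hamming ball of radius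
  \<open>r\<close>.\<close>

lemma switching:
  assumes "n \<ge> 1" "B \<subseteq> cols n" "Y \<subseteq> cols n"
    and "\<And>c. c \<in> B \<Longrightarrow> \<exists>c'\<in>Y. card {x\<in>{1..n}. c x \<noteq> c' x} \<le> r
           \<and> card (edges n c) + m \<le> card (edges n c')"
  shows "2 ^ m * (\<Sum>c\<in>B. wt n c) \<le> real (n * card V) ^ r * (\<Sum>c\<in>Y. wt n c)"
proof -
  obtain \<phi> where \<phi>: "\<And>c. c \<in> B \<Longrightarrow> \<phi> c \<in> Y \<and> card {x\<in>{1..n}. c x \<noteq> \<phi> c x} \<le> r
           \<and> card (edges n c) + m \<le> card (edges n (\<phi> c))"
    using assms(4) by metis
  have fin: "finite B" "finite Y" using assms finite_subset[OF _ finite_cols] by auto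
  have "2 ^ m * (\<Sum>c\<in>B. wt n c) = (\<Sum>c\<in>B. 2 ^ (card (edges n c) + m))"
    by (simp add: wt_def sum_distrib_left power_add mult_ac)
  also have "\<dots> \<le> (\<Sum>c\<in>B. wt n (\<phi> c))"
    unfolding wt_def using \<phi> by (intro sum_mono power_increasing) auto
  also have "\<dots> = (\<Sum>y\<in>Y. \<Sum>c | c \<in> B \<and> \<phi> c = y. wt n (\<phi> c))"
    using \<phi> fin by (intro sum.group[symmetric]) auto
  also have "\<dots> \<le> (\<Sum>y\<in>Y. real (n * card V) ^ r * wt n y)"
  proof (rule sum_mono)
    fix y assume y: "y \<in> Y"
    have "card {c. c \<in> B \<and> \<phi> c = y} \<le> card {c\<in>cols n. card {x\<in>{1..n}. c x \<noteq> y x} \<le> r}"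
      using \<phi> assms(2) by (intro card_mono) auto
    also have "\<dots> \<le> (n * card V) ^ r"
      using card_cols_ball assms y by auto
    finally have "real (card {c. c \<in> B \<and> \<phi> c = y}) \<le> real (n * card V) ^ r"
      by (metis of_nat_le_iff of_nat_power)
    moreover have "(\<Sum>c | c \<in> B \<and> \<phi> c = y. wt n (\<phi> c)) = card {c. c \<in> B \<and> \<phi> c = y} * wt n y"
      by simp
    ultimately show "(\<Sum>c | c \<in> B \<and> \<phi> c = y. wt n (\<phi> c)) \<le> real (n * card V) ^ r * wt n y"
      by (simp add: mult_right_mono less_imp_le)
  qed
  finally show ?thesis by (simp add: sum_distrib_left)
qed

definition twin_cols :: "nat \<Rightarrow> nat \<Rightarrow> 'v \<Rightarrow> 'v \<Rightarrow> (nat \<Rightarrow> 'v) set" where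
  "twin_cols n M u w = {c\<in>cols n. w \<notin> c ` {1..n} \<and> M \<le> class_size n c u
     \<and> (\<forall>v\<in>c ` {1..n}. adj v u \<longleftrightarrow> adj v w)}"

lemma twin_weight:
  assumes "u \<in> V" "w \<in> V" "u \<noteq> w"
  shows "2 ^ M * (\<Sum>c\<in>twin_cols n M u w. wt n c) \<le> (\<Sum>c\<in>cols n. wt n c)"
proof -
  define X where "X = twin_cols n M u w"
  note X_def = X_def[unfolded twin_cols_def]
  define cl where "cl c = {x\<in>{1..n}. c x = u}" for c
  define f where "f = (\<lambda>(c :: nat \<Rightarrow> 'v, A) x :: nat. if x \<in> A then w else c x)"
  have finX: "finite X" by (simp add: X_def)
  have f_cols: "f (c, A) \<in> cols n" if "c \<in> X" "A \<subseteq> cl c" for c A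
    using that assms(2) by (auto simp: f_def X_def cl_def PiE_iff extensional_def)
  have wt_f: "wt n (f (c, A)) = wt n c" if c: "c \<in> X" "A \<subseteq> cl c" for c A
  proof -
    have tw: "adj v u \<longleftrightarrow> adj v w" if "v \<in> c ` {1..n}" for v using c that by (auto simp: X_def)
    have A: "x \<in> {1..n}" "c x = u" if "x \<in> A" for x using c that by (auto simp: cl_def)
    have *: "adj (f (c, A) x) (f (c, A) y) \<longleftrightarrow> adj (c x) (c y)" if "x \<in> {1..n}" "y \<in> {1..n}" for x y
      using tw[of "c x"] tw[of "c y"] that A[of x] A[of y] adj_sym
      by (auto simp: f_def)
    have "card (edges n (f (c, A))) = card (edges n c)"
      by (intro antisym card_edges_mono) (use * in blast)+
    thus ?thesis by (simp add: wt_def)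
  qed
  have inj: "inj_on f (Sigma X (\<lambda>c. Pow (cl c)))"
  \<comment> \<open>The inverse acts on \<open>{1..n}\<close> only: elsewhere a colouring has the
    value \<open>undefined\<close>, which may coincide with \<open>w\<close>.\<close>
  proof (rule inj_on_inverseI[where g = "\<lambda>c'. ((\<lambda>x. if c' x = w \<and> x \<in> {1..n} then u else c' x),
           {x\<in>{1..n}. c' x = w})"])
    fix z assume "z \<in> Sigma X (\<lambda>c. Pow (cl c))"
    then obtain c A where z: "z = (c, A)" and c: "c \<in> X" "A \<subseteq> cl c" by auto
    have w: "c x \<noteq> w" if "x \<in> {1..n}" for x using c that by (auto simp: X_def)
    show "((\<lambda>x. if f z x = w \<and> x \<in> {1..n} then u else f z x), {x\<in>{1..n}. f z x = w}) = z"
      using w c by (fastforce simp: z f_def cl_def)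
  qed
  have "2 ^ M * (\<Sum>c\<in>X. wt n c) = (\<Sum>c\<in>X. 2 ^ M * wt n c)"
    by (simp add: sum_distrib_left)
  also have "\<dots> \<le> (\<Sum>c\<in>X. \<Sum>A\<in>Pow (cl c). wt n (f (c, A)))"
  proof (rule sum_mono)
    fix c assume c: "c \<in> X"
    have "(\<Sum>A\<in>Pow (cl c). wt n (f (c, A))) = (\<Sum>A\<in>Pow (cl c). wt n c)"
      using c wt_f by (intro sum.cong) auto
    also have "\<dots> = 2 ^ class_size n c u * wt n c"
      by (simp add: cl_def class_size_def card_Pow)
    finally show "2 ^ M * wt n c \<le> (\<Sum>A\<in>Pow (cl c). wt n (f (c, A)))"
      using c by (auto simp: X_def intro!: mult_right_mono power_increasing less_imp_le)
  qed
  also have "\<dots> = (\<Sum>z\<in>Sigma X (\<lambda>c. Pow (cl c)). wt n (f z))"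
    using finX by (subst sum.Sigma) (auto simp: cl_def intro!: sum.cong)
  also have "\<dots> = (\<Sum>c\<in>f ` Sigma X (\<lambda>c. Pow (cl c)). wt n c)"
    using inj by (simp add: sum.reindex)
  also have "\<dots> \<le> (\<Sum>c\<in>cols n. wt n c)"
    using f_cols by (intro sum_mono2) (auto simp: less_imp_le)
  finally show ?thesis by (simp add: X_def twin_cols_def)
qed

section \<open>Gains from low degrees and cherries\<close>

lemma class_size_recolour:
  assumes "A \<subseteq> {1..n}"
  shows "real (class_size n (\<lambda>y. if y \<in> A then v else c y) z) =
    class_size n c z + (of_bool (z = v) * real (card A) - real (card {x\<in>A. c x = z}))"
proof -
  let ?c = "\<lambda>y. if y \<in> A then v else c y"
  have fin: "finite A" using assms finite_subset by blast
  have "{x\<in>{1..n}. ?c x = z} = {x\<in>{1..n} - A. c x = z} \<union> (if z = v then A else {})"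
    using assms by auto
  moreover have "card ({x\<in>{1..n} - A. c x = z} \<union> (if z = v then A else {}))
      = card {x\<in>{1..n} - A. c x = z} + (if z = v then card A else 0)"
    using fin by (subst card_Un_disjoint) auto
  moreover have "class_size n c z = card {x\<in>{1..n} - A. c x = z} + card {x\<in>A. c x = z}"
    unfolding class_size_def using assms fin
    by (subst card_Un_disjoint[symmetric]) (auto intro!: arg_cong[where f = card])
  ultimately show ?thesis by (auto simp: class_size_def)
qed

lemma sum_indicator:
  fixes g :: "'v \<Rightarrow> real"
  shows "u \<in> V \<Longrightarrow> (\<Sum>z\<in>V. of_bool (z = u) * g z) = g u"
  using finV by (simp add: of_bool_def if_distrib[of "\<lambda>t. t * _"] cong: if_cong)

lemma recolour_cols:
  "c \<in> cols n \<Longrightarrow> A \<subseteq> {1..n} \<Longrightarrow> v \<in> V \<Longrightarrow> (\<lambda>y. if y \<in> A then v else c y) \<in> cols n"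
  by (auto simp: PiE_iff extensional_def)

definition low_degree :: "nat \<Rightarrow> nat \<Rightarrow> (nat \<Rightarrow> 'v) set" where
  "low_degree n L = {c\<in>cols n. \<exists>x\<in>{1..n}. \<exists>u\<in>V. deg n c (c x) + L < deg n c u}"

text \<open>Integrality turns the strict gap in \<open>low_degree\<close> into a gap of
  \<open>L + 1\<close>; the extra unit pays for the quadratic term.\<close>

lemma deg_int: "deg n c u = of_int (\<Sum>v\<in>V. of_bool (adj u v) * int (class_size n c v))"
  by (simp add: deg_def adjm_def)

text \<open>Moving \<open>x\<close> to colour \<open>u\<close> gains the difference of the degrees,
  less one if \<open>u\<close> is adjacent to \<open>c x\<close>, since \<open>x\<close> itself was
  then counted in the degree of \<open>u\<close>.\<close>

lemma low_degree_weight: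
  assumes "n \<ge> 1"
  shows "2 ^ L * (\<Sum>c\<in>low_degree n L. wt n c) \<le> (n * card V) * (\<Sum>c\<in>cols n. wt n c)"
proof -
  have "\<exists>c'\<in>cols n. card {x\<in>{1..n}. c x \<noteq> c' x} \<le> 1 \<and> card (edges n c) + L \<le> card (edges n c')"
    if "c \<in> low_degree n L" for c
  proof -
    from that obtain x u where c: "c \<in> cols n" and x: "x \<in> {1..n}" and u: "u \<in> V"
      and less: "deg n c (c x) + L < deg n c u" by (auto simp: low_degree_def)
    define c' where "c' = (\<lambda>y. if y \<in> {x} then u else c y)"
    define d :: "'v \<Rightarrow> real" where "d z = of_bool (z = u) - of_bool (z = c x)" for z
    have cx: "c x \<in> V" using c x by auto
    have c': "c' \<in> cols n" unfolding c'_def using c x u by (intro recolour_cols) auto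
    have d: "real (class_size n c' z) = class_size n c z + d z" for z
    proof -
      have "{y\<in>{x}. c y = z} = (if z = c x then {x} else {})" by auto
      thus ?thesis
        unfolding c'_def using x by (subst class_size_recolour) (auto simp: d_def)
    qed
    have sum_d: "(\<Sum>z\<in>V. d z * g z) = g u - g (c x)" for g :: "'v \<Rightarrow> real"
      by (simp only: d_def left_diff_distrib sum_subtractf sum_indicator[OF u] sum_indicator[OF cx])
    have "quad d = (\<Sum>z\<in>V. d z * (\<Sum>z'\<in>V. d z' * adjm z z'))"
      by (simp add: quad_def sum_distrib_left mult_ac)
    also have "\<dots> = - 2 * adjm u (c x)"
      by (simp add: sum_d) (simp add: adjm_def adj_sym)
    finally have "quad d \<ge> - 2" by (simp add: adjm_def)
    moreover have "deg n c (c x) + L + 1 \<le> deg n c u"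
    proof -
      obtain a b :: int where ab: "deg n c (c x) = a" "deg n c u = b"
        unfolding deg_int by blast
      with less have "real_of_int (a + int L) < real_of_int b" by simp
      hence "real_of_int (a + int L + 1) \<le> real_of_int b"
        by (simp only: of_int_less_iff of_int_le_iff)
      with ab show ?thesis by simp
    qed
    moreover note card_edges_perturb[OF c c' d]
    ultimately have "real (card (edges n c)) + L \<le> card (edges n c')"
      by (simp add: sum_d)
    moreover have "card {y\<in>{1..n}. c y \<noteq> c' y} \<le> card {x}"
      by (intro card_mono) (auto simp: c'_def)
    ultimately show ?thesis using c' by (intro bexI[of _ c']) auto
  qed
  from switching[OF assms _ _ this, of "low_degree n L"] show ?thesis
    by (auto simp: low_degree_def)
qed

text \<open>An edge and an isolated vertex, the induced pattern absent from complete multipartite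
  graphs; its two non-edges form a cherry in the complement. Only \<open>u\<close> and
  \<open>w\<close> give up vertices, so \<open>v\<close> may have a small class.\<close>

definition cherry :: "nat \<Rightarrow> nat \<Rightarrow> (nat \<Rightarrow> 'v) set" where
  "cherry n k = {c\<in>cols n. \<exists>v\<in>c ` {1..n}. \<exists>u\<in>V. \<exists>w\<in>V. adj u w \<and> \<not> adj v u \<and> \<not> adj v w
     \<and> k \<le> class_size n c u \<and> k \<le> class_size n c w}"

text \<open>Moving \<open>k\<close> vertices each from \<open>u\<close> and \<open>w\<close> to
  \<open>v\<close> costs at most \<open>2 * k * L\<close> in the linear term, as \<open>v\<close>
  has nearly maximal degree. That term subtracts the \<open>k * k\<close> pairs between the moved
  sets twice, though they are lost once; the quadratic term returns them.\<close>

lemma cherry_weight: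
  assumes "n \<ge> 1" "m + 2 * k * L \<le> k * k"
  shows "2 ^ m * (\<Sum>c\<in>cherry n k - low_degree n L. wt n c)
           \<le> real (n * card V) ^ (2 * k) * (\<Sum>c\<in>cols n. wt n c)"
proof -
  have "\<exists>c'\<in>cols n. card {x\<in>{1..n}. c x \<noteq> c' x} \<le> 2 * k \<and> card (edges n c) + m \<le> card (edges n c')"
    if "c \<in> cherry n k - low_degree n L" for c
  proof -
    from that obtain v u w where c: "c \<in> cols n" and v: "v \<in> c ` {1..n}" and uw: "u \<in> V" "w \<in> V"
      and adj: "adj u w" "\<not> adj v u" "\<not> adj v w"
      and size: "k \<le> class_size n c u" "k \<le> class_size n c w"
      by (auto simp: cherry_def)
    have vV: "v \<in> V" using c v by auto
    have deg: "deg n c z \<le> deg n c v + L" if "z \<in> V" for z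
      using \<open>c \<in> cherry n k - low_degree n L\<close> v that c by (force simp: low_degree_def)
    have neq: "u \<noteq> w" "v \<noteq> u" "v \<noteq> w" using adj adj_sym by auto
    obtain A where A: "A \<subseteq> {x\<in>{1..n}. c x = u}" "card A = k" "finite A"
      using size(1) unfolding class_size_def by (elim obtain_subset_with_card_n)
    obtain B where B: "B \<subseteq> {x\<in>{1..n}. c x = w}" "card B = k" "finite B"
      using size(2) unfolding class_size_def by (elim obtain_subset_with_card_n)
    have AB: "A \<inter> B = {}" "A \<union> B \<subseteq> {1..n}" using A B neq by auto
    have card_AB: "card (A \<union> B) = 2 * k" using A B AB by (simp add: card_Un_disjoint)
    define c' where "c' = (\<lambda>y. if y \<in> A \<union> B then v else c y)"
    define d where "d z = real k * (2 * of_bool (z = v) - of_bool (z = u) - of_bool (z = w))" for z :: 'v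
    have c': "c' \<in> cols n" unfolding c'_def using c AB vV by (intro recolour_cols) auto
    have "{x\<in>A \<union> B. c x = z} = (if z = u then A else if z = w then B else {})" for z
      using A B neq by auto
    hence "card {x\<in>A \<union> B. c x = z} = (if z = u \<or> z = w then k else 0)" for z
      using A B by simp
    hence d: "real (class_size n c' z) = class_size n c z + d z" for z
      unfolding c'_def class_size_recolour[OF AB(2)] using neq by (simp add: d_def card_AB)
    have sum_d: "(\<Sum>z\<in>V. d z * g z) = k * (2 * g v - g u - g w)" for g :: "'v \<Rightarrow> real"
    proof -
      have "(\<Sum>z\<in>V. d z * g z) = (\<Sum>z\<in>V. k * (2 * (of_bool (z = v) * g z)
          - of_bool (z = u) * g z - of_bool (z = w) * g z))"
        by (intro sum.cong) (auto simp: d_def)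
      thus ?thesis
        by (simp only: sum_distrib_left[symmetric] sum_subtractf sum_indicator uw vV)
    qed
    have "quad d = (\<Sum>z\<in>V. d z * (\<Sum>z'\<in>V. d z' * adjm z z'))"
      by (simp add: quad_def sum_distrib_left mult_ac)
    also have "\<dots> = 2 * real k * real k"
      using adj adj_sym by (simp add: sum_d) (simp add: adjm_def)
    finally have Q: "quad d = 2 * real k * real k" .
    have "deg n c u + deg n c w - 2 * deg n c v \<le> 2 * real L"
      using deg[OF uw(1)] deg[OF uw(2)] by linarith
    hence "real k * (deg n c u + deg n c w - 2 * deg n c v) \<le> real k * (2 * real L)"
      by (intro mult_left_mono) auto
    moreover have "real m + 2 * real k * real L \<le> real k * real k"
      using assms(2) by (metis of_nat_add of_nat_le_iff of_nat_mult of_nat_numeral)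
    moreover note card_edges_perturb[OF c c' d]
    ultimately have "real (card (edges n c)) + m \<le> card (edges n c')"
      by (simp add: sum_d Q algebra_simps)
    moreover have "card {y\<in>{1..n}. c y \<noteq> c' y} \<le> card (A \<union> B)"
      using A B by (intro card_mono) (auto simp: c'_def)
    ultimately show ?thesis using c' card_AB by (intro bexI[of _ c']) auto
  qed
  from switching[OF assms(1) _ _ this, of "cherry n k - low_degree n L"] show ?thesis
    by (auto simp: cherry_def)
qed

end

section \<open>Structure of near-extremal colourings\<close>

locale clique_bounded_graph = finite_oriented_graph V E for V :: "'v set" and E +
  fixes l :: nat
  assumes ex_clique: "\<exists>R\<subseteq>V. card R = l \<and> (\<forall>u\<in>R. \<forall>v\<in>R. u \<noteq> v \<longrightarrow> adj u v)"
    and clique_le: "\<And>R. R \<subseteq> V \<Longrightarrow> \<forall>u\<in>R. \<forall>v\<in>R. u \<noteq> v \<longrightarrow> adj u v \<Longrightarrow> card R \<le> l"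
begin

section \<open>Balanced clique colourings and the edge deficit\<close>

lemma l_pos: "l > 0"
proof -
  obtain v where "v \<in> V" using V_ne by auto
  thus ?thesis using clique_le[of "{v}"] by simp
qed

text \<open>Residues modulo \<open>l\<close> are coloured by the vertices of an
  \<open>l\<close>-clique, so a vertex misses only its own residue class.\<close>

lemma ex_balanced_colouring:
  "\<exists>c\<in>cols n. 2 * real (card (edges n c)) \<ge> real n ^ 2 - real n ^ 2 / l - n"
proof -
  obtain R where R: "R \<subseteq> V" "card R = l" "\<forall>u\<in>R. \<forall>v\<in>R. u \<noteq> v \<longrightarrow> adj u v"
    using ex_clique by blast
  have "finite R" using R finV finite_subset by blast
  then obtain f where f: "bij_betw f {0..<l} R"
    using R(2) ex_bij_betw_nat_finite[of R] by auto
  define c where "c = (\<lambda>x\<in>{1..n}. f (x mod l))"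
  have fR: "f (x mod l) \<in> R" for x using f l_pos by (auto simp: bij_betw_def)
  have c: "c \<in> cols n" using fR R by (auto simp: c_def)
  have "real n ^ 2 - real n ^ 2 / l - n = (\<Sum>x=1..n. real n - (real n / l + 1))"
    by (simp add: power2_eq_square algebra_simps)
  also have "\<dots> \<le> (\<Sum>x=1..n. \<Sum>y=1..n. adjm (c x) (c y))"
  proof (rule sum_mono)
    fix x assume x: "x \<in> {1..n}"
    \<comment> \<open>In a residue class \<open>y\<close> is determined by \<open>y div l\<close>,
      which has at most \<open>n div l + 1\<close> values.\<close>
    have "inj_on (\<lambda>y. y div l) {y\<in>{1..n}. x mod l = y mod l}"
      by (rule inj_onI) (metis (mono_tags, lifting) div_mod_decomp mem_Collect_eq)
    hence "card {y\<in>{1..n}. x mod l = y mod l} \<le> card {0..n div l}"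
      by (rule card_inj_on_le) (auto intro: div_le_mono)
    hence "real (card {y\<in>{1..n}. x mod l = y mod l}) \<le> n div l + 1" by simp
    also have "real (n div l + 1) \<le> real n / l + 1"
      using of_nat_div_le_of_nat[of n l, where 'a = real] by simp
    finally have *: "real (card {y\<in>{1..n}. x mod l = y mod l}) \<le> real n / l + 1" .
    have "(\<Sum>y=1..n. adjm (c x) (c y)) \<ge> (\<Sum>y=1..n. 1 - of_bool (x mod l = y mod l))"
    proof (rule sum_mono)
      fix y assume y: "y \<in> {1..n}"
      show "1 - of_bool (x mod l = y mod l) \<le> adjm (c x) (c y)"
      proof (cases "x mod l = y mod l")
        case False
        hence "f (x mod l) \<noteq> f (y mod l)"
          using f l_pos by (auto simp: bij_betw_def inj_on_def)
        thus ?thesis using R fR x y False by (simp add: adjm_def c_def)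
      qed (simp add: adjm_def)
    qed
    also have "(\<Sum>y=1..n. 1 - of_bool (x mod l = y mod l)) = real n - card {y\<in>{1..n}. x mod l = y mod l}"
      by (simp add: sum_subtractf Int_def)
    finally show "real n - (real n / l + 1) \<le> (\<Sum>y=1..n. adjm (c x) (c y))"
      using * by linarith
  qed
  finally show ?thesis using c by (auto simp: two_edges)
qed

text \<open>After the rounding loss \<open>n\<close> of the balanced colouring, the constant leaves
  a deficit of more than \<open>(card V + 1) * n\<close> edges: \<open>card V * n\<close> to
  outweigh the number of colourings, and \<open>n\<close> as net gain.\<close>

definition few_edges :: "nat \<Rightarrow> (nat \<Rightarrow> 'v) set" where
  "few_edges n = {c\<in>cols n.
     2 * real (card (edges n c)) < real n ^ 2 - real n ^ 2 / l - (2 * card V + 3) * n}"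

lemma few_edges_weight: "2 ^ n * (\<Sum>c\<in>few_edges n. wt n c) \<le> (\<Sum>c\<in>cols n. wt n c)"
proof -
  obtain c0 where c0: "c0 \<in> cols n" "2 * real (card (edges n c0)) \<ge> real n ^ 2 - real n ^ 2 / l - n"
    using ex_balanced_colouring by blast
  have *: "2 ^ n * wt n c \<le> wt n c0 / 2 ^ (card V * n)" if "c \<in> few_edges n" for c
  proof -
    have "real (card (edges n c)) + (card V + 1) * n \<le> card (edges n c0)"
      using that c0 by (simp add: few_edges_def algebra_simps)
    hence "card (edges n c) + card V * n + n \<le> card (edges n c0)"
      by (simp add: algebra_simps flip: of_nat_add of_nat_mult)
    hence "2 ^ (card (edges n c) + card V * n + n) \<le> (2::real) ^ card (edges n c0)"
      by (intro power_increasing) auto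
    thus ?thesis by (simp add: wt_def power_add field_simps)
  qed
  have "card (few_edges n) \<le> card (cols n)"
    by (intro card_mono) (auto simp: few_edges_def)
  also have "\<dots> = card V ^ n" using finV by (simp add: card_PiE)
  also have "\<dots> \<le> (2 ^ card V) ^ n" by (intro power_mono less_imp_le[OF less_exp]) auto
  finally have card: "real (card (few_edges n)) \<le> 2 ^ (card V * n)"
    by (metis of_nat_le_iff of_nat_numeral of_nat_power power_mult)
  have "2 ^ n * (\<Sum>c\<in>few_edges n. wt n c) \<le> (\<Sum>c\<in>few_edges n. wt n c0 / 2 ^ (card V * n))"
    unfolding sum_distrib_left by (intro sum_mono *)
  also have "\<dots> = card (few_edges n) * (wt n c0 / 2 ^ (card V * n))" by simp
  also have "\<dots> \<le> 2 ^ (card V * n) * (wt n c0 / 2 ^ (card V * n))"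
    by (intro mult_right_mono card) (simp add: less_imp_le)
  also have "\<dots> = wt n c0" by simp
  also have "\<dots> \<le> (\<Sum>c\<in>cols n. wt n c)"
    using c0 by (intro member_le_sum) (auto simp: less_imp_le)
  finally show ?thesis .
qed

text \<open>
  Turan's inequality: parts of sizes \<open>m r\<close> give \<open>2 e(c) \<le> n^2 - (\<Sum>r. (m r)^2)\<close>, and by Cauchy-Schwarz
  fewer than \<open>l\<close> parts cannot reach \<open>(1 - 1/l) n^2 - O(n)\<close> unless linearly many vertices lie outside.
\<close>

lemma few_parts_remainder:
  assumes c: "c \<in> cols n - few_edges n" and P: "P \<subseteq> V" "card (\<rho> ` P) < l"
    and ind: "\<And>u v. u \<in> P \<Longrightarrow> v \<in> P \<Longrightarrow> \<rho> u = \<rho> v \<Longrightarrow> \<not> adj u v"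
    and small: "\<And>u. u \<in> V - P \<Longrightarrow> class_size n c u \<le> M"
  shows "n \<le> 2 * l * card V * M + l\<^sup>2 * (2 * card V + 3)"
proof -
  let ?x = "\<lambda>u. real (class_size n c u)"
  define K where "K = real (2 * card V + 3)"
  define s where "s = (\<Sum>u\<in>V - P. ?x u)"
  define m where "m r = (\<Sum>u | u \<in> P \<and> \<rho> u = r. ?x u)" for r
  have finP: "finite P" using P finV finite_subset by blast
  have X: "(\<Sum>u\<in>V. ?x u) = n" using c sum_class_size by auto
  have "s \<le> (\<Sum>u\<in>V - P. real M)"
    unfolding s_def using small by (intro sum_mono) auto
  also have "\<dots> \<le> card V * real M"
    using finV by (simp add: mult_right_mono card_mono)
  finally have s_le: "s \<le> card V * real M" .
  have m_sum: "(\<Sum>r\<in>\<rho> ` P. m r) = n - s"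
    unfolding m_def using sum.group[OF finP _ subset_refl, of \<rho> ?x]
      sum.subset_diff[OF P(1) finV, of ?x] X finP by (simp add: s_def)
  have "(n - s)\<^sup>2 \<le> (\<Sum>r\<in>\<rho> ` P. (m r)\<^sup>2) * card (\<rho> ` P)"
    using sum_squared_le_sum_of_squares[of m "\<rho> ` P"] by (simp add: m_sum)
  also have "\<dots> \<le> (\<Sum>r\<in>\<rho> ` P. (m r)\<^sup>2) * (real l - 1)"
    using P(2) by (intro mult_left_mono sum_nonneg) auto
  finally have CS: "(n - s)\<^sup>2 \<le> (\<Sum>r\<in>\<rho> ` P. (m r)\<^sup>2) * (real l - 1)" .
  have "(\<Sum>r\<in>\<rho> ` P. (m r)\<^sup>2) =
      (\<Sum>r\<in>\<rho> ` P. \<Sum>u | u \<in> P \<and> \<rho> u = r. \<Sum>v\<in>P. of_bool (\<rho> v = \<rho> u) * ?x u * ?x v)"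
  proof (rule sum.cong[OF refl])
    fix r
    have "(\<Sum>v\<in>P. of_bool (\<rho> v = r) * ?x u * ?x v) = ?x u * m r" for u
    proof -
      have "(\<Sum>v\<in>P. of_bool (\<rho> v = r) * ?x u * ?x v) = (\<Sum>v\<in>P. if \<rho> v = r then ?x u * ?x v else 0)"
        by (intro sum.cong) auto
      also have "\<dots> = (\<Sum>v | v \<in> P \<and> \<rho> v = r. ?x u * ?x v)"
        using finP by (simp add: sum.If_cases Int_def)
      finally show ?thesis by (simp add: m_def sum_distrib_left)
    qed
    hence "(\<Sum>u | u \<in> P \<and> \<rho> u = r. \<Sum>v\<in>P. of_bool (\<rho> v = \<rho> u) * ?x u * ?x v)
      = (\<Sum>u | u \<in> P \<and> \<rho> u = r. ?x u * m r)" by (intro sum.cong) auto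
    thus "(m r)\<^sup>2 = (\<Sum>u | u \<in> P \<and> \<rho> u = r. \<Sum>v\<in>P. of_bool (\<rho> v = \<rho> u) * ?x u * ?x v)"
      by (simp add: power2_eq_square m_def sum_distrib_right)
  qed
  also have "\<dots> = (\<Sum>u\<in>P. \<Sum>v\<in>P. of_bool (\<rho> v = \<rho> u) * ?x u * ?x v)"
    using finP by (intro sum.group) auto
  \<comment> \<open>The sum of squares counts ordered pairs of vertices in a common part; by
    \<open>ind\<close> these are among the non-adjacent pairs.\<close>
  also have "\<dots> \<le> (\<Sum>u\<in>P. \<Sum>v\<in>P. (1 - adjm u v) * ?x u * ?x v)"
    using ind by (intro sum_mono mult_right_mono) (auto simp: adjm_def)
  also have "\<dots> \<le> (\<Sum>u\<in>P. \<Sum>v\<in>V. (1 - adjm u v) * ?x u * ?x v)"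
    using P finV by (intro sum_mono sum_mono2) (auto simp: adjm_def)
  also have "\<dots> \<le> (\<Sum>u\<in>V. \<Sum>v\<in>V. (1 - adjm u v) * ?x u * ?x v)"
    using P finV by (intro sum_mono2 sum_nonneg) (auto simp: adjm_def)
  also have "\<dots> = (\<Sum>u\<in>V. ?x u) * (\<Sum>v\<in>V. ?x v) - quad ?x"
    by (simp add: quad_def sum_product sum_subtractf algebra_simps)
  also have "\<dots> = real n ^ 2 - 2 * card (edges n c)"
    using c quad_class_size by (simp add: X power2_eq_square)
  also have "\<dots> \<le> real n ^ 2 / l + K * n"
    using c by (auto simp: few_edges_def K_def)
  finally have "(\<Sum>r\<in>\<rho> ` P. (m r)\<^sup>2) * (real l - 1) \<le> (real n ^ 2 / l + K * n) * (real l - 1)"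
    using l_pos by (intro mult_right_mono) auto
  with CS have "(n - s)\<^sup>2 \<le> (real n ^ 2 / l + K * n) * (real l - 1)" by linarith
  also have "\<dots> = real n ^ 2 - real n ^ 2 / l + K * n * real l - K * n"
    using l_pos by (simp add: field_simps)
  also have "\<dots> \<le> real n ^ 2 - real n ^ 2 / l + K * n * real l"
    by (simp add: K_def)
  \<comment> \<open>Expand the square and drop the square of \<open>s\<close>; the terms
    \<open>n^2\<close> cancel.\<close>
  finally have "real n ^ 2 / l \<le> 2 * n * s + K * n * real l"
    by (simp add: power2_eq_square algebra_simps) (smt (verit) zero_le_square)
  hence "real n * real n \<le> real n * (2 * l * s + K * (real l)\<^sup>2)"
    using l_pos by (simp add: field_simps power2_eq_square)
  hence "real n \<le> 2 * l * s + K * (real l)\<^sup>2"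
    by (cases "n = 0") (auto simp: K_def s_def intro!: add_nonneg_nonneg mult_nonneg_nonneg sum_nonneg)
  also have "\<dots> \<le> 2 * l * (card V * real M) + K * (real l)\<^sup>2"
    using s_le by (intro add_right_mono mult_left_mono) auto
  also have "\<dots> = real (2 * l * card V * M + l\<^sup>2 * (2 * card V + 3))"
    by (simp add: K_def algebra_simps)
  finally show ?thesis by linarith
qed

definition recolourable :: "nat \<Rightarrow> nat \<Rightarrow> nat \<Rightarrow> (nat \<Rightarrow> 'v) set" where
  "recolourable n r M = {c\<in>cols n. \<exists>u\<in>V. \<exists>w\<in>V. u \<noteq> w \<and> (\<exists>c'\<in>twin_cols n M u w.
     card {x\<in>{1..n}. c x \<noteq> c' x} \<le> r \<and> card (edges n c) \<le> card (edges n c'))}"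

text \<open>Switching with gain 0 leads into \<open>twin_cols\<close>, where
  \<open>twin_weight\<close> supplies the factor \<open>2 ^ M\<close>; the square of
  \<open>card V\<close> counts the choices of \<open>u\<close> and \<open>w\<close>.\<close>

lemma recolourable_weight:
  assumes "n \<ge> 1"
  shows "2 ^ M * (\<Sum>c\<in>recolourable n r M. wt n c)
    \<le> real (card V) ^ 2 * real (n * card V) ^ r * (\<Sum>c\<in>cols n. wt n c)"
proof -
  define I where "I = {(u, w). u \<in> V \<and> w \<in> V \<and> u \<noteq> w}"
  define B where "B = (\<lambda>(u, w). {c\<in>cols n. \<exists>c'\<in>twin_cols n M u w.
     card {x\<in>{1..n}. c x \<noteq> c' x} \<le> r \<and> card (edges n c) \<le> card (edges n c')})"
  have I: "I \<subseteq> V \<times> V" "finite I"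
    using finV by (auto simp: I_def intro: finite_subset[of _ "V \<times> V"])
  have "recolourable n r M = (\<Union>i\<in>I. B i)"
    by (auto simp: recolourable_def I_def B_def)
  hence "(\<Sum>c\<in>recolourable n r M. wt n c) \<le> (\<Sum>i\<in>I. \<Sum>c\<in>B i. wt n c)"
    using I(2) by (simp only:) (rule sum_UN_le, auto simp: B_def less_imp_le)
  hence "2 ^ M * (\<Sum>c\<in>recolourable n r M. wt n c) \<le> 2 ^ M * (\<Sum>i\<in>I. \<Sum>c\<in>B i. wt n c)"
    by simp
  also have "\<dots> = (\<Sum>i\<in>I. 2 ^ M * (\<Sum>c\<in>B i. wt n c))"
    by (simp add: sum_distrib_left)
  also have "\<dots> \<le> (\<Sum>i\<in>I. real (n * card V) ^ r * (\<Sum>c\<in>cols n. wt n c))"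
  proof (rule sum_mono)
    fix i assume "i \<in> I"
    then obtain u w where i: "i = (u, w)" and uw: "u \<in> V" "w \<in> V" "u \<noteq> w" by (auto simp: I_def)
    have "2 ^ 0 * (\<Sum>c\<in>B i. wt n c)
        \<le> real (n * card V) ^ r * (\<Sum>c\<in>twin_cols n M u w. wt n c)"
      using assms by (intro switching) (auto simp: B_def i twin_cols_def)
    hence "2 ^ M * (\<Sum>c\<in>B i. wt n c)
        \<le> 2 ^ M * (real (n * card V) ^ r * (\<Sum>c\<in>twin_cols n M u w. wt n c))"
      by simp
    also have "\<dots> = real (n * card V) ^ r * (2 ^ M * (\<Sum>c\<in>twin_cols n M u w. wt n c))"
      by simp
    also have "\<dots> \<le> real (n * card V) ^ r * (\<Sum>c\<in>cols n. wt n c)"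
      by (intro mult_left_mono twin_weight uw) simp
    finally show "2 ^ M * (\<Sum>c\<in>B i. wt n c) \<le> real (n * card V) ^ r * (\<Sum>c\<in>cols n. wt n c)" .
  qed
  also have "\<dots> = card I * (real (n * card V) ^ r * (\<Sum>c\<in>cols n. wt n c))" by simp
  also have "\<dots> \<le> real (card V) ^ 2 * (real (n * card V) ^ r * (\<Sum>c\<in>cols n. wt n c))"
  proof (rule mult_right_mono)
    have "card I \<le> card (V \<times> V)" using I finV by (intro card_mono) auto
    thus "real (card I) \<le> real (card V) ^ 2"
      by (simp add: card_cartesian_product power2_eq_square flip: of_nat_mult)
  qed (auto intro!: mult_nonneg_nonneg sum_nonneg simp: less_imp_le)
  finally show ?thesis by (simp add: mult_ac)
qed

section \<open>Complete multipartite structure of typical colourings\<close>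

definition multipartite :: "nat \<Rightarrow> (nat \<Rightarrow> 'v) \<Rightarrow> bool" where
  "multipartite n c \<longleftrightarrow> (\<exists>p. p ` c ` {1..n} = {0..<l} \<and>
     (\<forall>u\<in>c ` {1..n}. \<forall>v\<in>c ` {1..n}. adj u v \<longleftrightarrow> p u \<noteq> p v))"

text \<open>Without cherries, non-adjacency is transitive on the large classes, so a maximal clique
  \<open>R\<close> among them represents the parts, and the edge count forces \<open>l\<close>
  parts. Each used colour joins the part of its unique non-neighbour in \<open>R\<close>. A small
  class, if any, has a large twin in its part.\<close>

lemma typical_multipartite:
  assumes c: "c \<in> cols n" "c \<notin> cherry n k" "c \<notin> few_edges n"
    and k: "1 \<le> k" "k \<le> M" and n: "2 * l * card V * M + l\<^sup>2 * (2 * card V + 3) < n"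
  shows "multipartite n c \<or> c \<in> recolourable n (card V * k) M"
proof -
  define S where "S = c ` {1..n}"
  define T where "T = {u\<in>V. k \<le> class_size n c u}"
  define clique where "clique R \<longleftrightarrow> (\<forall>u\<in>R. \<forall>v\<in>R. u \<noteq> v \<longrightarrow> adj u v)" for R
  have SV: "S \<subseteq> V" using c by (auto simp: S_def)
  have TS: "T \<subseteq> S"
  proof
    fix u assume "u \<in> T"
    hence "card {x\<in>{1..n}. c x = u} > 0" using k by (simp add: T_def class_size_def)
    hence "{x\<in>{1..n}. c x = u} \<noteq> {}" by (metis card.empty less_irrefl)
    thus "u \<in> S" by (auto simp: S_def)
  qed
  have TV: "T \<subseteq> V" by (auto simp: T_def)
  have finT: "finite T" using TV finV finite_subset by blast
  have trans: "\<not> adj u w" if "v \<in> S" "u \<in> T" "w \<in> T" "\<not> adj v u" "\<not> adj v w" for u v w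
    using that c by (auto simp: cherry_def S_def T_def)
  have "finite {R. R \<subseteq> T \<and> clique R}" "{R. R \<subseteq> T \<and> clique R} \<noteq> {}"
    using finT by (auto simp: clique_def intro!: exI[of _ "{}"])
  from finite_has_maximal[OF this] obtain R where R: "R \<subseteq> T" "clique R"
    and maxR: "\<And>R'. R' \<subseteq> T \<Longrightarrow> clique R' \<Longrightarrow> R \<subseteq> R' \<Longrightarrow> R = R'" by auto
  have RV: "R \<subseteq> V" and finR: "finite R" using R TV finT finite_subset by auto
  have clique_insert: "clique (insert v Q)" if "clique Q" "\<And>r. r \<in> Q \<Longrightarrow> adj v r" for v Q
    using that adj_sym by (auto simp: clique_def)
  have card_clique: "card Q \<le> l" if "clique Q" "Q \<subseteq> V" for Q
    using that clique_le by (auto simp: clique_def)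
  \<comment> \<open>By maximality of \<open>R\<close>; a member of \<open>R\<close> is its own
    witness.\<close>
  have "\<exists>r\<in>R. \<not> adj u r" if "u \<in> T" for u
    using maxR[of "insert u R"] clique_insert[of R u] R that adj_irrefl by blast
  then obtain \<rho>\<^sub>0 where \<rho>\<^sub>0: "\<And>u. u \<in> T \<Longrightarrow> \<rho>\<^sub>0 u \<in> R \<and> \<not> adj u (\<rho>\<^sub>0 u)" by metis
  have cardR: "card R = l"
  proof (rule ccontr)
    assume "card R \<noteq> l"
    hence "card R < l" using card_clique[of R] R RV by auto
    moreover have "card (\<rho>\<^sub>0 ` T) \<le> card R" using \<rho>\<^sub>0 finR by (intro card_mono) auto
    ultimately have *: "card (\<rho>\<^sub>0 ` T) < l" by simp
    \<comment> \<open>The fibres of \<open>\<rho>\<^sub>0\<close> would be fewer than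
      \<open>l\<close> independent sets covering \<open>T\<close>, while classes outside
      \<open>T\<close> are smaller than \<open>k \<le> M\<close>.\<close>
    have "n \<le> 2 * l * card V * M + l\<^sup>2 * (2 * card V + 3)"
    proof (rule few_parts_remainder[OF _ TV *])
      fix u v assume "u \<in> T" "v \<in> T" "\<rho>\<^sub>0 u = \<rho>\<^sub>0 v"
      thus "\<not> adj u v" using \<rho>\<^sub>0[of u] \<rho>\<^sub>0[of v] trans[of "\<rho>\<^sub>0 u" u v] R TS adj_sym by auto
    qed (use c k in \<open>auto simp: T_def\<close>)
    with n show False by simp
  qed
  have "\<exists>r\<in>R. \<not> adj v r" if "v \<in> S" for v
  proof (rule ccontr)
    assume *: "\<not> (\<exists>r\<in>R. \<not> adj v r)"
    hence "v \<notin> R" by auto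
    hence "card (insert v R) = Suc l" using cardR finR by simp
    thus False using card_clique[of "insert v R"] clique_insert[of R v] R RV * SV that by auto
  qed
  then obtain \<rho> where \<rho>: "\<And>v. v \<in> S \<Longrightarrow> \<rho> v \<in> R \<and> \<not> adj v (\<rho> v)" by metis
  have uniq: "\<rho> v = r" if "v \<in> S" "r \<in> R" "\<not> adj v r" for v r
    using trans[of v "\<rho> v" r] \<rho>[of v] that R by (auto simp: clique_def)
  have \<rho>_R: "\<rho> r = r" if "r \<in> R" for r
    using that uniq R TS by auto
  have same: "\<not> adj v v'" if v: "v \<in> S" "v' \<in> S" "\<rho> v = \<rho> v'" for v v'
  proof
    assume adj: "adj v v'"
    define Q where "Q = R - {\<rho> v}"
    have "clique Q" using R by (auto simp: Q_def clique_def)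
    moreover have vQ: "adj v r" "adj v' r" if "r \<in> Q" for r
      using that uniq[of v r] uniq[of v' r] v by (auto simp: Q_def)
    ultimately have "clique (insert v (insert v' Q))"
      using adj by (intro clique_insert) auto
    hence le: "card (insert v (insert v' Q)) \<le> l"
      using v SV RV by (intro card_clique) (auto simp: Q_def)
    have "v \<noteq> v'" "v \<notin> Q" "v' \<notin> Q"
      using adj vQ adj_irrefl by metis+
    moreover have "card Q = l - 1" using cardR finR \<rho> v by (simp add: Q_def)
    ultimately show False using le l_pos finR by (simp add: Q_def)
  qed
  have diff: "adj v u" if "v \<in> S" "u \<in> T" "\<rho> v \<noteq> \<rho> u" for u v
  proof (rule ccontr)
    assume "\<not> adj v u"
    hence "\<not> adj u (\<rho> v)" using trans[of v u "\<rho> v"] \<rho> that R by auto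
    hence "\<rho> u = \<rho> v" using uniq[of u "\<rho> v"] that TS \<rho> by auto
    thus False using that by simp
  qed
  show ?thesis
  proof (cases "S \<subseteq> T")
    case True
    hence [simp]: "T = S" using TS by auto
    obtain g where g: "bij_betw g R {0..<l}"
      using ex_bij_betw_finite_nat[OF finR] cardR by auto
    have "\<rho> ` S = R" using \<rho> \<rho>_R R by force
    hence "(\<lambda>v. g (\<rho> v)) ` S = {0..<l}"
      using g by (simp add: bij_betw_def image_image[symmetric, of g \<rho>])
    moreover have "adj u v \<longleftrightarrow> g (\<rho> u) \<noteq> g (\<rho> v)" if "u \<in> S" "v \<in> S" for u v
    proof -
      have "g (\<rho> u) = g (\<rho> v) \<longleftrightarrow> \<rho> u = \<rho> v"
        using g \<rho> that by (auto simp: bij_betw_def inj_on_def)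
      thus ?thesis using same[of u v] diff[of u v] that by auto
    qed
    ultimately show ?thesis unfolding multipartite_def S_def by blast
  next
    case False
    then obtain w where w: "w \<in> S" "w \<notin> T" by auto
    define P where "P = {u\<in>T. \<rho> u \<noteq> \<rho> w}"
    \<comment> \<open>The large colours outside the part of \<open>w\<close> meet at most
      \<open>l - 1\<close> parts, so some class outside \<open>P\<close> exceeds \<open>M\<close>;
      being large, it lies in the part of \<open>w\<close>.\<close>
    have "\<exists>u\<in>V - P. \<not> class_size n c u \<le> M"
    proof (rule ccontr)
      assume *: "\<not> ?thesis"
      have "card (\<rho> ` P) \<le> card (R - {\<rho> w})"
        using \<rho> finR TS by (intro card_mono) (auto simp: P_def)
      also have "\<dots> < l" using \<rho> w cardR finR l_pos by simp
      finally have "card (\<rho> ` P) < l" .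
      moreover have "P \<subseteq> V" using TV by (auto simp: P_def)
      moreover have "\<not> adj u v" if "u \<in> P" "v \<in> P" "\<rho> u = \<rho> v" for u v
        using that same TS by (auto simp: P_def)
      ultimately have "n \<le> 2 * l * card V * M + l\<^sup>2 * (2 * card V + 3)"
        using * c by (intro few_parts_remainder) auto
      with n show False by simp
    qed
    then obtain u where u: "u \<in> V" "u \<notin> P" "class_size n c u > M" by auto
    hence uT: "u \<in> T" using k by (auto simp: T_def)
    hence \<rho>u: "\<rho> u = \<rho> w" using u by (auto simp: P_def)
    \<comment> \<open>Small classes move to the representatives of their parts, which frees
      \<open>w\<close>. The guard preserves \<open>undefined\<close> outside
      \<open>{1..n}\<close>.\<close>
    define c' where "c' x = (if x \<in> {1..n} \<and> c x \<notin> T then \<rho> (c x) else c x)" for x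
    have cS: "c x \<in> S" if "x \<in> {1..n}" for x using that by (auto simp: S_def)
    have c'T: "c' x \<in> T" if "x \<in> {1..n}" for x
      using that \<rho> cS R by (auto simp: c'_def)
    have \<rho>c': "\<rho> (c' x) = \<rho> (c x)" if "x \<in> {1..n}" for x
      using \<rho>[OF cS[OF that]] \<rho>_R by (auto simp: c'_def)
    have c'_cols: "c' \<in> cols n"
    proof (rule PiE_I)
      fix x assume "x \<in> {1..n}" thus "c' x \<in> V" using c'T TV by auto
    next
      fix x assume "x \<notin> {1..n}" thus "c' x = undefined" using c by (auto simp: c'_def)
    qed
    have "c' \<in> twin_cols n M u w"
    proof -
      have "class_size n c u \<le> class_size n c' u"
        unfolding class_size_def using uT by (intro card_mono) (auto simp: c'_def)
      moreover have "adj v u \<longleftrightarrow> adj v w" if "v \<in> c' ` {1..n}" for v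
      proof -
        have v: "v \<in> T" "v \<in> S" using that c'T TS by auto
        have "adj v u \<longleftrightarrow> \<rho> v \<noteq> \<rho> u" using same[of v u] diff[of v u] v uT TS by auto
        moreover have "adj v w \<longleftrightarrow> \<rho> v \<noteq> \<rho> w"
          using same[of v w] diff[of w v] v w adj_sym by auto
        ultimately show ?thesis using \<rho>u by simp
      qed
      ultimately show ?thesis using c'_cols c'T w u by (auto simp: twin_cols_def)
    qed
    moreover have "card {x\<in>{1..n}. c x \<noteq> c' x} \<le> card V * k"
    proof -
      have "card {x\<in>{1..n}. c x \<noteq> c' x} \<le> card (\<Union>u\<in>V - T. {x\<in>{1..n}. c x = u})"
        using finV c(1) by (intro card_mono) (auto simp: c'_def)
      also have "\<dots> \<le> (\<Sum>u\<in>V - T. class_size n c u)"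
        unfolding class_size_def using finV by (intro card_UN_le) auto
      also have "\<dots> \<le> (\<Sum>u\<in>V - T. k)" by (intro sum_mono) (auto simp: T_def)
      also have "\<dots> \<le> card V * k" using finV by (simp add: card_mono)
      finally show ?thesis .
    qed
    moreover have "card (edges n c) \<le> card (edges n c')"
    proof (rule card_edges_mono)
      fix x y assume xy: "x \<in> {1..n}" "y \<in> {1..n}" "adj (c x) (c y)"
      \<comment> \<open>Parts are unchanged, and between large colours distinct parts mean
        adjacency.\<close>
      hence "\<rho> (c' x) \<noteq> \<rho> (c' y)" using same[of "c x" "c y"] cS \<rho>c' by auto
      thus "adj (c' x) (c' y)" using diff c'T TS xy by blast
    qed
    moreover have "u \<noteq> w" using uT w by auto
    moreover have "w \<in> V" using w SV by auto
    ultimately show ?thesis using u(1) c(1) unfolding recolourable_def by blast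
  qed
qed

section \<open>The limit\<close>

lemma card_coloured_digraphs:
  "real (card {cG\<in>coloured_digraphs V E n. P (fst cG)}) = (\<Sum>c | c \<in> cols n \<and> P c. wt n c)"
proof -
  have irr: "(u, u) \<notin> E" for u using oriented by (auto simp: oriented_graph_def irrefl_def)
  \<comment> \<open>For fixed \<open>c\<close> the digraphs are the subsets of
    \<open>edges n c\<close>; loops are excluded since \<open>E\<close> has none.\<close>
  have "{cG\<in>coloured_digraphs V E n. P (fst cG)} = Sigma {c\<in>cols n. P c} (\<lambda>c. Pow (edges n c))"
    using irr by (fastforce simp: coloured_digraphs_def edges_def irrefl_def)
  hence "card {cG\<in>coloured_digraphs V E n. P (fst cG)} = (\<Sum>c | c \<in> cols n \<and> P c. card (Pow (edges n c)))"
    by (simp add: card_SigmaI)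
  thus ?thesis by (simp add: wt_def card_Pow)
qed

lemma multipartite_image_in_blowup:
  assumes "cG \<in> coloured_digraphs V E n" "multipartite n (fst cG)"
  shows "image_in_blowup V E l n cG"
proof -
  obtain c G where cG: "cG = (c, G)" by (cases cG)
  define W where "W = c ` {1..n}"
  define F where "F = E \<inter> W \<times> W"
  obtain p where p: "p ` W = {0..<l}" "\<And>u v. u \<in> W \<Longrightarrow> v \<in> W \<Longrightarrow> adj u v \<longleftrightarrow> p u \<noteq> p v"
    using assms(2) unfolding multipartite_def cG W_def by auto
  have "W \<subseteq> V" using assms by (auto simp: coloured_digraphs_def cG W_def)
  hence "subgraph W F V E" by (auto simp: subgraph_def F_def)
  moreover have "orientation_of_blowup_K l W F"
    unfolding orientation_of_blowup_K_def using p oriented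
    by (auto simp: F_def adj_def oriented_graph_def antisym_def intro!: exI[of _ p])
  moreover have "(\<lambda>(x, y). (c x, c y)) ` G \<subseteq> F"
    using assms by (fastforce simp: coloured_digraphs_def cG W_def F_def)
  ultimately show ?thesis unfolding image_in_blowup_def cG W_def by blast
qed

section \<open>Union bound and asymptotics\<close>

lemma blowup_fraction_bounds:
  assumes n: "n \<ge> 1" and k: "1 \<le> k" "k \<le> M" and m: "m + 2 * k * L \<le> k * k"
    and M: "2 * l * card V * M + l\<^sup>2 * (2 * card V + 3) < n"
  defines "\<rho> \<equiv> real (card {cG\<in>coloured_digraphs V E n. image_in_blowup V E l n cG})
               / real (card (coloured_digraphs V E n))"
  shows "\<rho> \<le> 1" "1 - (real (n * card V) / 2 ^ L + real (n * card V) ^ (2 * k) / 2 ^ m + 1 / 2 ^ n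
           + real (card V) ^ 2 * real (n * card V) ^ (card V * k) / 2 ^ M) \<le> \<rho>"
proof -
  define Z where "Z = (\<Sum>c\<in>cols n. wt n c)"
  let ?good = "{c\<in>cols n. multipartite n c}"
  define B1 where "B1 = low_degree n L"
  define B2 where "B2 = cherry n k - low_degree n L"
  define B3 where "B3 = few_edges n"
  define B4 where "B4 = recolourable n (card V * k) M"
  have fin: "finite (cols n)" by simp
  have Z_pos: "Z > 0"
    unfolding Z_def using V_ne fin by (intro sum_pos) (auto simp: PiE_eq_empty_iff)
  have finB: "finite B1" "finite B2" "finite B3" "finite B4"
    using fin by (auto simp: B1_def B2_def B3_def B4_def
        low_degree_def cherry_def few_edges_def recolourable_def)
  have total: "real (card (coloured_digraphs V E n)) = Z"
    using card_coloured_digraphs[of n "\<lambda>_. True"] by (simp add: Z_def)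
  have fin_dig: "finite (coloured_digraphs V E n)"
    using total Z_pos card.infinite by fastforce
  show "\<rho> \<le> 1"
    unfolding \<rho>_def total using Z_pos fin_dig
    by (simp add: total[symmetric] card_mono)
  \<comment> \<open>A colouring with a cherry lies in \<open>B1\<close> or \<open>B2\<close>, so
    \<open>typical_multipartite\<close> applies outside the four sets.\<close>
  have "cols n \<subseteq> ?good \<union> (B1 \<union> (B2 \<union> (B3 \<union> B4)))"
    using typical_multipartite[OF _ _ _ k M] by (auto simp: B1_def B2_def B3_def B4_def)
  hence "Z \<le> sum (wt n) (?good \<union> (B1 \<union> (B2 \<union> (B3 \<union> B4))))"
    unfolding Z_def using finB by (intro sum_mono2) (auto simp: less_imp_le)
  also have "\<dots> \<le> sum (wt n) ?good + (sum (wt n) B1 + (sum (wt n) B2 + (sum (wt n) B3 + sum (wt n) B4)))"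
    using finB by (intro order_trans[OF sum_Un_le] add_left_mono) (auto simp: less_imp_le)
  finally have "Z \<le> \<dots>" .
  moreover have "sum (wt n) B1 \<le> real (n * card V) / 2 ^ L * Z"
    using low_degree_weight[OF n, of L] by (simp add: Z_def B1_def B2_def B3_def B4_def field_simps)
  moreover have "sum (wt n) B2 \<le> real (n * card V) ^ (2 * k) / 2 ^ m * Z"
    using cherry_weight[OF n m] by (simp add: Z_def B1_def B2_def B3_def B4_def field_simps)
  moreover have "sum (wt n) B3 \<le> 1 / 2 ^ n * Z"
    using few_edges_weight[of n] by (simp add: Z_def B1_def B2_def B3_def B4_def field_simps)
  moreover have "sum (wt n) B4
      \<le> real (card V) ^ 2 * real (n * card V) ^ (card V * k) / 2 ^ M * Z"
    using recolourable_weight[OF n, of M "card V * k"] by (simp add: Z_def B1_def B2_def B3_def B4_def field_simps)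
  ultimately have "(1 - (real (n * card V) / 2 ^ L + real (n * card V) ^ (2 * k) / 2 ^ m + 1 / 2 ^ n
      + real (card V) ^ 2 * real (n * card V) ^ (card V * k) / 2 ^ M)) * Z \<le> sum (wt n) ?good"
    by (simp add: algebra_simps)
  also have "\<dots> = real (card {cG\<in>coloured_digraphs V E n. multipartite n (fst cG)})"
    by (simp add: card_coloured_digraphs)
  also have "\<dots> \<le> real (card {cG\<in>coloured_digraphs V E n. image_in_blowup V E l n cG})"
    using fin_dig multipartite_image_in_blowup by (auto intro!: card_mono)
  finally show "1 - (real (n * card V) / 2 ^ L + real (n * card V) ^ (2 * k) / 2 ^ m + 1 / 2 ^ n
           + real (card V) ^ 2 * real (n * card V) ^ (card V * k) / 2 ^ M) \<le> \<rho>"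
    using Z_pos by (simp add: \<rho>_def total field_simps)
qed

text \<open>With \<open>L = k div 4\<close> and \<open>m = k * k div 2\<close>, the loss
  \<open>2 * k * L\<close> is at most half of \<open>k * k\<close>. As \<open>k\<close> is about
  \<open>sqrt n\<close> and \<open>M\<close> is linear in \<open>n\<close>, each error term has an
  exponentially larger denominator.\<close>

lemma blowup_fraction_tendsto:
  "(\<lambda>n. real (card {cG\<in>coloured_digraphs V E n. image_in_blowup V E l n cG})
       / real (card (coloured_digraphs V E n))) \<longlonglongrightarrow> 1"
proof -
  define k where "k n = nat \<lfloor>sqrt (real n)\<rfloor>" for n :: nat
  \<comment> \<open>The final 1 makes the size condition strict: \<open>b * M n + C \<le> n\<close>
    once \<open>n \<ge> C\<close>.\<close>
  define C where "C = l\<^sup>2 * (2 * card V + 3) + 1"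
  define N where "N = card V"
  define b where "b = 2 * l * N"
  define M where "M n = (n - C) div b" for n
  define err where "err n = real (n * N) / 2 ^ (k n div 4)
      + real (n * N) ^ (2 * k n) / 2 ^ (k n * k n div 2) + 1 / 2 ^ n
      + real N ^ 2 * real (n * N) ^ (N * k n) / 2 ^ M n" for n
  \<comment> \<open>A majorant of \<open>err\<close> without floors: \<open>k n\<close> is at least
    \<open>sqrt n - 1\<close>, and each integer division loses at most 1.\<close>
  define err' where "err' x = x * N / 2 powr ((sqrt x - 5) / 4)
      + (x * N) powr (2 * sqrt x) / 2 powr (((sqrt x - 1)\<^sup>2 - 2) / 2) + 1 / 2 powr x
      + real N ^ 2 * (x * N) powr (N * sqrt x) / 2 powr ((x - C) / b - 1)" for x :: real
  have N: "N > 0" using finV V_ne by (auto simp: N_def card_gt_0_iff)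
  have b: "b > 0" using N l_pos by (simp add: b_def)
  have div_ge: "real j / real q - 1 \<le> real (j div q)" if "q > 0" for j q :: nat
    using floor_divide_of_nat_eq[of j q, where 'a = real] by linarith
  have k_le: "real (k n) \<le> sqrt n" for n by (simp add: k_def)
  have k_ge: "real (k n) \<ge> sqrt n - 1" for n unfolding k_def by linarith
  have M_ge: "real (M n) \<ge> (real n - C) / b - 1" for n
  proof -
    have "(real n - C) / b \<le> real (n - C) / b"
      using b by (intro divide_right_mono) linarith+
    thus ?thesis using div_ge[OF b, of "n - C"] by (simp add: M_def)
  qed
  have err'_lim: "((\<lambda>n. err' (real n)) \<longlongrightarrow> 0) sequentially"
  proof -
    define a d e where "a = real N" and "d = real b" and "e = real C"
    have "a > 0" "d > 0" using N b by (auto simp: a_def d_def)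
    thus ?thesis unfolding err'_def a_def[symmetric] d_def[symmetric] e_def[symmetric]
      by real_asymp
  qed
  have err_le: "err n \<le> err' n" if n: "n \<ge> 1" for n
  proof -
    have nN: "real (n * N) \<ge> 1" using N n by (metis Suc_leI One_nat_def mult_le_mono mult_1 of_nat_1 of_nat_le_iff)
    have pw: "real (n * N) ^ j \<le> (real n * real N) powr s" if "real j \<le> s" for j s
      using nN that by (subst powr_realpow[symmetric]) (auto intro: powr_mono)
    have pw2: "(2::real) ^ j \<ge> 2 powr s" if "s \<le> real j" for j s
      using that by (subst powr_realpow[symmetric]) (auto intro: powr_mono)
    have "(sqrt n - 1)\<^sup>2 \<le> real (k n) ^ 2"
      using k_ge[of n] n by (intro power_mono) auto
    hence "(sqrt n - 1)\<^sup>2 \<le> real (k n * k n)"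
      by (simp add: power2_eq_square)
    with div_ge[of 2 "k n * k n"]
    have kk: "((sqrt n - 1)\<^sup>2 - 2) / 2 \<le> real (k n * k n div 2)"
      by simp
    have kd: "(sqrt n - 5) / 4 \<le> real (k n div 4)"
      using k_ge[of n] div_ge[of 4 "k n"] by simp
    show ?thesis unfolding err_def err'_def
      using k_le[of n] kk kd M_ge[of n] nN
      by (intro add_mono frac_le mult_mono pw pw2) (auto intro!: mult_left_mono)
  qed
  have "eventually (\<lambda>n. sqrt (real n) \<le> (real n - C) / b - 1) sequentially"
  proof -
    define d e where "d = real b" and "e = real C"
    have "d > 0" using b by (auto simp: d_def)
    thus ?thesis unfolding d_def[symmetric] e_def[symmetric] by real_asymp
  qed
  hence ev: "eventually (\<lambda>n. n \<ge> C \<and> n \<ge> 1 \<and> 1 \<le> k n \<and> k n \<le> M n) sequentially"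
    using eventually_ge_at_top[of "C + 1"]
  proof eventually_elim
    case (elim n)
    hence "real (k n) \<le> real (M n)" using k_le[of n] M_ge[of n] by linarith
    moreover have "1 \<le> k n"
      using elim by (simp add: k_def le_nat_iff le_floor_iff)
    ultimately show ?case using elim by simp
  qed
  let ?\<rho> = "\<lambda>n. real (card {cG\<in>coloured_digraphs V E n. image_in_blowup V E l n cG})
       / real (card (coloured_digraphs V E n))"
  have bounds: "?\<rho> n \<le> 1 \<and> 1 - err' (real n) \<le> ?\<rho> n"
    if n: "n \<ge> C" "n \<ge> 1" "1 \<le> k n" "k n \<le> M n" for n
  proof -
    have "k n * (4 * (k n div 4)) \<le> k n * k n" by (intro mult_left_mono) auto
    hence m: "k n * k n div 2 + 2 * k n * (k n div 4) \<le> k n * k n" by linarith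
    have "b * M n \<le> n - C" by (simp add: M_def)
    hence M: "2 * l * card V * M n + l\<^sup>2 * (2 * card V + 3) < n"
      using n by (simp add: b_def N_def C_def)
    from blowup_fraction_bounds[OF n(2-4) m M] err_le[OF n(2)] show ?thesis
      by (simp add: err_def N_def)
  qed
  show ?thesis
  proof (rule tendsto_sandwich)
    show "eventually (\<lambda>n. 1 - err' (real n) \<le> ?\<rho> n) sequentially"
      using ev by eventually_elim (use bounds in blast)
    show "eventually (\<lambda>n. ?\<rho> n \<le> 1) sequentially"
      using ev by eventually_elim (use bounds in blast)
    show "(\<lambda>n. 1 - err' (real n)) \<longlonglongrightarrow> 1"
      using tendsto_diff[OF tendsto_const[of 1] err'_lim] by simp
  qed simp
qed

end

section \<open>Translation from oriented complete subgraphs to cliques\<close>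

theorem theorem4p11:
  fixes V :: "'v set" and E :: "('v \<times> 'v) set" and l :: nat
  assumes "finite V" and "V \<noteq> {}" and "oriented_graph V E"
    and "contains_oriented_K V E l"
    and "\<forall>k. contains_oriented_K V E k \<longrightarrow> k \<le> l"
  shows "(\<lambda>n. real (card {cG \<in> coloured_digraphs V E n. image_in_blowup V E l n cG})
               / real (card (coloured_digraphs V E n))) \<longlonglongrightarrow> 1"
proof -
  interpret finite_oriented_graph V E
    using assms by unfold_locales
  have contains_iff: "contains_oriented_K V E k \<longleftrightarrow>
      (\<exists>R\<subseteq>V. card R = k \<and> (\<forall>u\<in>R. \<forall>v\<in>R. u \<noteq> v \<longrightarrow> adj u v))" (is "_ \<longleftrightarrow> ?rhs") for k
  proof
    assume "contains_oriented_K V E k"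
    then obtain R F where "subgraph R F V E" "card R = k" "orientation_of_complete R F"
      by (auto simp: contains_oriented_K_def)
    thus ?rhs
      by (intro exI[of _ R]) (auto simp: subgraph_def orientation_of_complete_def adj_def)
  next
    assume ?rhs
    then obtain R where R: "R \<subseteq> V" "card R = k" "\<forall>u\<in>R. \<forall>v\<in>R. u \<noteq> v \<longrightarrow> adj u v" by blast
    \<comment> \<open>A clique inherits its directions from \<open>E\<close>, and antisymmetry makes
      them unique.\<close>
    have "orientation_of_complete R (E \<inter> R \<times> R)"
      using R(3) assms(3)
      by (auto simp: orientation_of_complete_def adj_def oriented_graph_def irrefl_def antisym_def)
    moreover have "subgraph R (E \<inter> R \<times> R) V E" using R by (auto simp: subgraph_def)
    moreover have "finite R" using R(1) finV by (rule finite_subset)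
    ultimately show "contains_oriented_K V E k"
      unfolding contains_oriented_K_def using R(2) by blast
  qed
  interpret clique_bounded_graph V E l
  proof
    show "\<exists>R\<subseteq>V. card R = l \<and> (\<forall>u\<in>R. \<forall>v\<in>R. u \<noteq> v \<longrightarrow> adj u v)"
      using assms(4) unfolding contains_iff .
    show "card R \<le> l" if "R \<subseteq> V" "\<forall>u\<in>R. \<forall>v\<in>R. u \<noteq> v \<longrightarrow> adj u v" for R
      using assms(5) that unfolding contains_iff by blast
  qed
  show ?thesis by (rule blowup_fraction_tendsto)
qed

end
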